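(* Let $A$ be an integral domain and $E$ a divisible $A$-module. Then $A\propto E$ is a strongly ISP-ring if and only if $A$ is an ISP-domain and $E$ is a simple $A$-module.
   Context: All rings are commutative with a nonzero unit; modules are unitary. The trivial ring extension $A\propto E$ is the ring with underlying additive group $A\times E$ and multiplication $(a,e)(b,f)=(ab,af+be)$. An $A$-module $E$ is divisible if $E=aE$ for every regular (i.e. non-zero-divisor) element $a\in A$. An $A$-module is called simple here if it has no proper nonzero submodule. An ideal is regular if it contains at least one regular element. A proper ideal $H$ is a radical ideal if $\sqrt H=H$. An ideal $J$ of a ring $R$ is invertible if $JJ'=R$ for some $R$-submodule $J'$ of the total quotient ring $T(R)$; equivalently, $J$ is finitely generated, regular, and $J_M$ is a principal ideal of $R_M$ for each maximal ideal $M$ of $R$ (the ideal $R$ itself is allowed). A ring is a strongly ISP-ring if every proper ideal of it (including the zero ideal) can be written as $JH_1\cdots H_n$ with $J$ an invertible ideal, $n\ge 1$, and all $H_i$ proper radical ideals. An ISP-domain is an integral domain all of whose proper ideals have such a factorization. *)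

theory Defs
  imports
    "HOL-Algebra.Module"
    "HOL-Algebra.Ideal_Product"
    "HOL-Algebra.Generated_Groups"
begin

definition regular_elements :: "('a, 'm) ring_scheme \<Rightarrow> 'a set" where
  "regular_elements R =
     {a \<in> carrier R. \<forall>b\<in>carrier R. a \<otimes>\<^bsub>R\<^esub> b = \<zero>\<^bsub>R\<^esub> \<longrightarrow> b = \<zero>\<^bsub>R\<^esub>}"

definition proper_ideal :: "'a set \<Rightarrow> ('a, 'm) ring_scheme \<Rightarrow> bool" where
  "proper_ideal I R \<longleftrightarrow> ideal I R \<and> I \<noteq> carrier R"

definition ideal_radical :: "('a, 'm) ring_scheme \<Rightarrow> 'a set \<Rightarrow> 'a set" where
  "ideal_radical R I = {x \<in> carrier R. \<exists>n::nat. n > 0 \<and> x [^]\<^bsub>R\<^esub> n \<in> I}"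

definition radical_ideal :: "'a set \<Rightarrow> ('a, 'm) ring_scheme \<Rightarrow> bool" where
  "radical_ideal H R \<longleftrightarrow> proper_ideal H R \<and> ideal_radical R H = H"


section \<open>The total quotient ring\<close>

definition fraction_rel ::
    "('a, 'm) ring_scheme \<Rightarrow> (('a \<times> 'a) \<times> ('a \<times> 'a)) set" where
  "fraction_rel R =
     {((a, s), (b, t)). a \<in> carrier R \<and> s \<in> regular_elements R \<and>
                        b \<in> carrier R \<and> t \<in> regular_elements R \<and>
                        a \<otimes>\<^bsub>R\<^esub> t = b \<otimes>\<^bsub>R\<^esub> s}"

definition fraction :: "('a, 'm) ring_scheme \<Rightarrow> 'a \<Rightarrow> 'a \<Rightarrow> ('a \<times> 'a) set" where
  "fraction R a s = fraction_rel R `` {(a, s)}"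

text \<open>
  The record type of modules is used so that T(R) is at once a ring and an R-module (it is an
  R-algebra, see \<open>algebra_total_quotient_ring\<close>).  Each operation takes the union of the classes
  obtained from all representatives; these classes all coincide, see the computation rules below.
\<close>

definition total_quotient_ring ::
    "('a, 'm) ring_scheme \<Rightarrow> ('a, ('a \<times> 'a) set) module" where
  "total_quotient_ring R =
     \<lparr> carrier = (carrier R \<times> regular_elements R) // fraction_rel R,
       mult = (\<lambda>X Y. \<Union>(a, s)\<in>X. \<Union>(b, t)\<in>Y. fraction R (a \<otimes>\<^bsub>R\<^esub> b) (s \<otimes>\<^bsub>R\<^esub> t)),
       one = fraction R \<one>\<^bsub>R\<^esub> \<one>\<^bsub>R\<^esub>,
       zero = fraction R \<zero>\<^bsub>R\<^esub> \<one>\<^bsub>R\<^esub>,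
       add = (\<lambda>X Y. \<Union>(a, s)\<in>X. \<Union>(b, t)\<in>Y.
                fraction R (a \<otimes>\<^bsub>R\<^esub> t \<oplus>\<^bsub>R\<^esub> b \<otimes>\<^bsub>R\<^esub> s) (s \<otimes>\<^bsub>R\<^esub> t)),
       smult = (\<lambda>r X. \<Union>(a, s)\<in>X. fraction R (r \<otimes>\<^bsub>R\<^esub> a) s) \<rparr>"


section \<open>Invertible ideals and ISP-rings\<close>

text \<open>
  The product of an ideal J of R and an R-submodule K of T(R) is the additive subgroup of T(R)
  generated by all products of an element of J and an element of K.
\<close>

definition ideal_submodule_prod ::
    "('a, 'm) ring_scheme \<Rightarrow> 'a set \<Rightarrow> ('a \<times> 'a) set set \<Rightarrow> ('a \<times> 'a) set set" where
  "ideal_submodule_prod R J K =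
     generate (add_monoid (total_quotient_ring R))
       {j \<odot>\<^bsub>total_quotient_ring R\<^esub> x | j x. j \<in> J \<and> x \<in> K}"

text \<open>In the last conjunct, R is identified with its image in T(R).\<close>

definition invertible_ideal :: "'a set \<Rightarrow> ('a, 'm) ring_scheme \<Rightarrow> bool" where
  "invertible_ideal J R \<longleftrightarrow>
     ideal J R \<and>
     (\<exists>K. submodule K R (total_quotient_ring R) \<and>
          ideal_submodule_prod R J K = (\<lambda>r. fraction R r \<one>\<^bsub>R\<^esub>) ` carrier R)"

definition ISP_factorization :: "('a, 'm) ring_scheme \<Rightarrow> 'a set \<Rightarrow> bool" where
  "ISP_factorization R I \<longleftrightarrow>
     (\<exists>J Hs. invertible_ideal J R \<and> Hs \<noteq> [] \<and> (\<forall>H\<in>set Hs. radical_ideal H R) \<and>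
             I = foldl (ideal_prod R) J Hs)"

definition strongly_ISP_ring :: "('a, 'm) ring_scheme \<Rightarrow> bool" where
  "strongly_ISP_ring R \<longleftrightarrow>
     cring R \<and> \<one>\<^bsub>R\<^esub> \<noteq> \<zero>\<^bsub>R\<^esub> \<and> (\<forall>I. proper_ideal I R \<longrightarrow> ISP_factorization R I)"

definition ISP_domain :: "('a, 'm) ring_scheme \<Rightarrow> bool" where
  "ISP_domain R \<longleftrightarrow> domain R \<and> (\<forall>I. proper_ideal I R \<longrightarrow> ISP_factorization R I)"


section \<open>Modules and trivial extensions\<close>

definition divisible_module ::
    "('a, 'm) ring_scheme \<Rightarrow> ('a, 'e, 'n) module_scheme \<Rightarrow> bool" where
  "divisible_module A E \<longleftrightarrow>
     module A E \<and> (\<forall>a\<in>regular_elements A. carrier E = (\<lambda>e. a \<odot>\<^bsub>E\<^esub> e) ` carrier E)"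

text \<open>With this convention the zero module is simple.\<close>

definition simple_module ::
    "('a, 'm) ring_scheme \<Rightarrow> ('a, 'e, 'n) module_scheme \<Rightarrow> bool" where
  "simple_module A E \<longleftrightarrow>
     module A E \<and> (\<forall>N. submodule N A E \<longrightarrow> N = {\<zero>\<^bsub>E\<^esub>} \<or> N = carrier E)"

definition trivial_extension ::
    "('a, 'm) ring_scheme \<Rightarrow> ('a, 'e, 'n) module_scheme \<Rightarrow> ('a \<times> 'e) ring" where
  "trivial_extension A E =
     \<lparr> carrier = carrier A \<times> carrier E,
       mult = (\<lambda>(a, e) (b, f). (a \<otimes>\<^bsub>A\<^esub> b, a \<odot>\<^bsub>E\<^esub> f \<oplus>\<^bsub>E\<^esub> b \<odot>\<^bsub>E\<^esub> e)),
       one = (\<one>\<^bsub>A\<^esub>, \<zero>\<^bsub>E\<^esub>),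
       zero = (\<zero>\<^bsub>A\<^esub>, \<zero>\<^bsub>E\<^esub>),
       add = (\<lambda>(a, e) (b, f). (a \<oplus>\<^bsub>A\<^esub> b, e \<oplus>\<^bsub>E\<^esub> f)) \<rparr>"


section \<open>Well-definedness\<close>

lemma (in module) cring_trivial_extension: "cring (trivial_extension R M)"
proof (rule cringI)
  show "abelian_group (trivial_extension R M)"
  proof (rule abelian_groupI)
    fix x assume "x \<in> carrier (trivial_extension R M)"
    then show "\<exists>y\<in>carrier (trivial_extension R M).
        y \<oplus>\<^bsub>trivial_extension R M\<^esub> x = \<zero>\<^bsub>trivial_extension R M\<^esub>"
      by (intro bexI[of _ "(\<ominus> fst x, \<ominus>\<^bsub>M\<^esub> snd x)"])
         (auto simp: trivial_extension_def R.l_neg M.l_neg)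
  qed (auto simp: trivial_extension_def R.a_ac M.a_ac)
  show "comm_monoid (trivial_extension R M)"
    by (rule comm_monoidI)
       (auto simp: trivial_extension_def R.m_ac M.a_ac smult_r_distr smult_assoc1[symmetric])
qed (auto simp: trivial_extension_def R.l_distr smult_l_distr smult_r_distr M.a_ac)

lemma UN_pair_const:
  assumes "(a, s) \<in> X" and "\<And>a s. (a, s) \<in> X \<Longrightarrow> f a s = C"
  shows "(\<Union>(a, s)\<in>X. f a s) = C"
  using assms by auto

lemma UN_pairs_const:
  assumes "(a, s) \<in> X" "(b, t) \<in> Y"
    and "\<And>a s b t. (a, s) \<in> X \<Longrightarrow> (b, t) \<in> Y \<Longrightarrow> f a s b t = C"
  shows "(\<Union>(a, s)\<in>X. \<Union>(b, t)\<in>Y. f a s b t) = C"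
  by (rule UN_pair_const[OF assms(1)], rule UN_pair_const[OF assms(2)], rule assms(3))

context cring
begin

lemma regular_closed: "s \<in> regular_elements R \<Longrightarrow> s \<in> carrier R"
  by (simp add: regular_elements_def)

lemma one_regular: "\<one> \<in> regular_elements R"
  by (simp add: regular_elements_def)

lemma mult_regular:
  assumes "s \<in> regular_elements R" "t \<in> regular_elements R"
  shows "s \<otimes> t \<in> regular_elements R"
  unfolding regular_elements_def mem_Collect_eq
proof (intro conjI ballI impI)
  have c: "s \<in> carrier R" "t \<in> carrier R"
    using assms regular_closed by auto
  then show "s \<otimes> t \<in> carrier R" by simp
  fix b assume b: "b \<in> carrier R" and "(s \<otimes> t) \<otimes> b = \<zero>"
  then have e: "s \<otimes> (t \<otimes> b) = \<zero>"
    using c b by (simp add: m_assoc)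
  have "t \<otimes> b = \<zero>"
    using assms(1) e m_closed[OF c(2) b] unfolding regular_elements_def by blast
  then show "b = \<zero>"
    using assms(2) b unfolding regular_elements_def by blast
qed

lemma regular_cancel:
  assumes s: "s \<in> regular_elements R" and a: "a \<in> carrier R" and b: "b \<in> carrier R"
    and eq: "s \<otimes> a = s \<otimes> b"
  shows "a = b"
proof -
  have sc: "s \<in> carrier R" using s by (rule regular_closed)
  have "s \<otimes> (a \<ominus> b) = s \<otimes> a \<oplus> \<ominus> (s \<otimes> b)"
    using sc a b by (simp add: a_minus_def r_distr r_minus)
  also have "\<dots> = \<zero>"
    unfolding eq using sc b by (simp add: r_neg)
  finally have "s \<otimes> (a \<ominus> b) = \<zero>" .
  moreover have "a \<ominus> b \<in> carrier R"
    using a b by simp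
  ultimately have z: "a \<ominus> b = \<zero>"
    using s unfolding regular_elements_def by blast
  have "a = (a \<ominus> b) \<oplus> b"
    using a b by (simp add: a_minus_def a_assoc l_neg)
  also have "\<dots> = b"
    unfolding z using b by simp
  finally show ?thesis .
qed

lemma equiv_fraction_rel: "equiv (carrier R \<times> regular_elements R) (fraction_rel R)"
proof (rule equivI)
  show "fraction_rel R \<subseteq> (carrier R \<times> regular_elements R) \<times> (carrier R \<times> regular_elements R)"
    by (auto simp: fraction_rel_def)
  show "refl_on (carrier R \<times> regular_elements R) (fraction_rel R)"
    by (auto simp: refl_on_def fraction_rel_def)
  show "sym (fraction_rel R)"
    by (auto simp: sym_def fraction_rel_def)
  show "trans (fraction_rel R)"
  proof (rule transI, clarsimp simp: fraction_rel_def)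
    fix a s b t c u
    assume r: "s \<in> regular_elements R" "t \<in> regular_elements R" "u \<in> regular_elements R"
      and c: "a \<in> carrier R" "b \<in> carrier R" "c \<in> carrier R"
      and e1: "a \<otimes> t = b \<otimes> s" and e2: "b \<otimes> u = c \<otimes> t"
    have rc: "s \<in> carrier R" "t \<in> carrier R" "u \<in> carrier R"
      using r regular_closed by auto
    have "t \<otimes> (a \<otimes> u) = (a \<otimes> t) \<otimes> u" using rc c by (simp add: m_ac)
    also have "\<dots> = (b \<otimes> u) \<otimes> s" unfolding e1 using rc c by (simp add: m_ac)
    also have "\<dots> = t \<otimes> (c \<otimes> s)" unfolding e2 using rc c by (simp add: m_ac)
    finally show "a \<otimes> u = c \<otimes> s"
      using regular_cancel[OF r(2)] rc c by blast
  qed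
qed

lemma fraction_eq_iff:
  assumes "a \<in> carrier R" "s \<in> regular_elements R" "b \<in> carrier R" "t \<in> regular_elements R"
  shows "fraction R a s = fraction R b t \<longleftrightarrow> a \<otimes> t = b \<otimes> s"
  using eq_equiv_class_iff[OF equiv_fraction_rel, of "(a, s)" "(b, t)"] assms
  by (simp add: fraction_def fraction_rel_def)

lemma total_quotient_ring_cases:
  assumes "X \<in> carrier (total_quotient_ring R)"
  obtains a s where "a \<in> carrier R" "s \<in> regular_elements R" "X = fraction R a s"
  using assms by (auto simp: total_quotient_ring_def fraction_def elim!: quotientE)

lemma fraction_closed:
  assumes "a \<in> carrier R" "s \<in> regular_elements R"
  shows "fraction R a s \<in> carrier (total_quotient_ring R)"
  using assms by (auto simp: total_quotient_ring_def fraction_def intro: quotientI)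

lemma fraction_mem:
  assumes "a \<in> carrier R" "s \<in> regular_elements R"
  shows "(a, s) \<in> fraction R a s"
  using assms by (simp add: fraction_def fraction_rel_def)

lemma fraction_memD:
  assumes "(b, t) \<in> fraction R a s"
  shows "b \<in> carrier R" "t \<in> regular_elements R" "a \<otimes> t = b \<otimes> s"
  using assms by (auto simp: fraction_def fraction_rel_def)

lemma fraction_mult:
  assumes "a \<in> carrier R" "s \<in> regular_elements R" "b \<in> carrier R" "t \<in> regular_elements R"
  shows "fraction R a s \<otimes>\<^bsub>total_quotient_ring R\<^esub> fraction R b t = fraction R (a \<otimes> b) (s \<otimes> t)"
proof -
  have eq: "fraction R (a' \<otimes> b') (s' \<otimes> t') = fraction R (a \<otimes> b) (s \<otimes> t)"
    if x: "(a', s') \<in> fraction R a s" and y: "(b', t') \<in> fraction R b t" for a' s' b' t'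
  proof -
    note X = fraction_memD[OF x] and Y = fraction_memD[OF y]
    have c: "s \<in> carrier R" "t \<in> carrier R" "s' \<in> carrier R" "t' \<in> carrier R"
      using assms X Y regular_closed by auto
    have "(a' \<otimes> b') \<otimes> (s \<otimes> t) = (a' \<otimes> s) \<otimes> (b' \<otimes> t)"
      using c assms X Y by (simp add: m_ac)
    also have "\<dots> = (a \<otimes> b) \<otimes> (s' \<otimes> t')"
      unfolding X(3)[symmetric] Y(3)[symmetric] using c assms X(1,2) Y(1,2) by (simp add: m_ac)
    finally show ?thesis
      using assms X Y mult_regular by (subst fraction_eq_iff) auto
  qed
  show ?thesis
    by (simp add: total_quotient_ring_def)
       (rule UN_pairs_const[OF fraction_mem[OF assms(1,2)] fraction_mem[OF assms(3,4)] eq])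
qed

lemma fraction_add:
  assumes "a \<in> carrier R" "s \<in> regular_elements R" "b \<in> carrier R" "t \<in> regular_elements R"
  shows "fraction R a s \<oplus>\<^bsub>total_quotient_ring R\<^esub> fraction R b t
           = fraction R (a \<otimes> t \<oplus> b \<otimes> s) (s \<otimes> t)"
proof -
  have eq: "fraction R (a' \<otimes> t' \<oplus> b' \<otimes> s') (s' \<otimes> t') = fraction R (a \<otimes> t \<oplus> b \<otimes> s) (s \<otimes> t)"
    if x: "(a', s') \<in> fraction R a s" and y: "(b', t') \<in> fraction R b t" for a' s' b' t'
  proof -
    note X = fraction_memD[OF x] and Y = fraction_memD[OF y]
    have c: "s \<in> carrier R" "t \<in> carrier R" "s' \<in> carrier R" "t' \<in> carrier R"
      using assms X Y regular_closed by auto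
    have "(a' \<otimes> t' \<oplus> b' \<otimes> s') \<otimes> (s \<otimes> t) = (a' \<otimes> s) \<otimes> (t' \<otimes> t) \<oplus> (b' \<otimes> t) \<otimes> (s' \<otimes> s)"
      using c assms X(1,2) Y(1,2) by (simp add: m_ac l_distr r_distr)
    also have "\<dots> = (a \<otimes> t \<oplus> b \<otimes> s) \<otimes> (s' \<otimes> t')"
      unfolding X(3)[symmetric] Y(3)[symmetric] using c assms X(1,2) Y(1,2)
      by (simp add: m_ac l_distr r_distr)
    finally show ?thesis
      using c assms X Y mult_regular by (subst fraction_eq_iff) auto
  qed
  show ?thesis
    by (simp add: total_quotient_ring_def)
       (rule UN_pairs_const[OF fraction_mem[OF assms(1,2)] fraction_mem[OF assms(3,4)] eq])
qed

lemma fraction_smult: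
  assumes "r \<in> carrier R" "a \<in> carrier R" "s \<in> regular_elements R"
  shows "r \<odot>\<^bsub>total_quotient_ring R\<^esub> fraction R a s = fraction R (r \<otimes> a) s"
proof -
  have eq: "fraction R (r \<otimes> a') s' = fraction R (r \<otimes> a) s"
    if x: "(a', s') \<in> fraction R a s" for a' s'
  proof -
    note X = fraction_memD[OF x]
    have "(r \<otimes> a') \<otimes> s = (r \<otimes> a) \<otimes> s'"
      using X assms regular_closed by (simp add: m_assoc)
    then show ?thesis using X assms by (subst fraction_eq_iff) auto
  qed
  show ?thesis
    by (simp add: total_quotient_ring_def) (rule UN_pair_const[OF fraction_mem[OF assms(2,3)] eq])
qed

lemma total_quotient_ring_zero: "\<zero>\<^bsub>total_quotient_ring R\<^esub> = fraction R \<zero> \<one>"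
  and total_quotient_ring_one: "\<one>\<^bsub>total_quotient_ring R\<^esub> = fraction R \<one> \<one>"
  by (simp_all add: total_quotient_ring_def)

lemma cring_total_quotient_ring: "cring (total_quotient_ring R)"
proof (rule cringI)
  note rules = fraction_add fraction_mult fraction_closed fraction_eq_iff mult_regular
    one_regular regular_closed total_quotient_ring_zero total_quotient_ring_one
  show "abelian_group (total_quotient_ring R)"
  proof (rule abelian_groupI)
    fix X assume "X \<in> carrier (total_quotient_ring R)"
    then obtain a s where "a \<in> carrier R" "s \<in> regular_elements R" "X = fraction R a s"
      by (rule total_quotient_ring_cases)
    then show "\<exists>Y\<in>carrier (total_quotient_ring R).
        Y \<oplus>\<^bsub>total_quotient_ring R\<^esub> X = \<zero>\<^bsub>total_quotient_ring R\<^esub>"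
      by (intro bexI[of _ "fraction R (\<ominus> a) s"]) (simp_all add: rules l_minus l_neg)
  qed ((elim total_quotient_ring_cases)?, simp add: rules l_distr r_distr m_ac a_ac)+
  show "comm_monoid (total_quotient_ring R)"
    by (rule comm_monoidI) ((elim total_quotient_ring_cases)?, simp add: rules m_ac)+
qed (elim total_quotient_ring_cases,
     simp add: fraction_add fraction_mult fraction_closed fraction_eq_iff mult_regular
       regular_closed l_distr r_distr m_ac)

lemma algebra_total_quotient_ring: "algebra R (total_quotient_ring R)"
  by (rule algebraI[OF is_cring cring_total_quotient_ring])
     ((elim total_quotient_ring_cases)?,
      simp add: fraction_add fraction_mult fraction_smult fraction_closed fraction_eq_iff
         mult_regular regular_closed one_regular total_quotient_ring_one l_distr r_distr m_ac)+

lemma regular_fraction_inverse: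
  assumes "s \<in> regular_elements R"
  shows "fraction R s \<one> \<otimes>\<^bsub>total_quotient_ring R\<^esub> fraction R \<one> s = \<one>\<^bsub>total_quotient_ring R\<^esub>"
  using assms
  by (simp add: fraction_mult fraction_eq_iff one_regular regular_closed total_quotient_ring_one)

lemma inj_on_fraction_one: "inj_on (\<lambda>r. fraction R r \<one>) (carrier R)"
  by (rule inj_onI) (simp add: fraction_eq_iff one_regular)

end

end

theory Submission
  imports Defs "HOL-Algebra.QuotRing"
begin

text \<open>
  If E = 0, then \<open>A \<propto> E\<close> is isomorphic to A, so only the invariance of ISP-factorizations under
  isomorphism is needed. Let \<open>E \<noteq> 0\<close> and Z = 0 \<open>\<propto>\<close> E. A radical ideal of \<open>A \<propto> E\<close> contains the nilpotent
  ideal Z, so it either equals Z or has an element with non-zero first component; an invertible ideal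
  is regular and so has such an element. As A is a domain, E is divisible and Z Z = 0, a product of
  such ideals that lies in Z is Z or 0. Applied to the ideals 0 \<open>\<propto>\<close> N, this shows that E is simple.
  Conversely, a domain A with a non-zero simple divisible module is a field, and then the only
  proper ideals of \<open>A \<propto> E\<close> are the radical ideal Z and 0 = Z Z.
\<close>

section \<open>Invertible ideals\<close>

lemma (in cring) fraction_a_inv:
  assumes "a \<in> carrier R" "s \<in> regular_elements R"
  shows "\<ominus>\<^bsub>total_quotient_ring R\<^esub> fraction R a s = fraction R (\<ominus> a) s"
proof -
  interpret T: cring "total_quotient_ring R" by (rule cring_total_quotient_ring)
  have "fraction R (\<ominus> a) s \<oplus>\<^bsub>total_quotient_ring R\<^esub> fraction R a s = \<zero>\<^bsub>total_quotient_ring R\<^esub>"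
    using assms regular_closed[OF assms(2)]
    by (simp add: fraction_add fraction_eq_iff mult_regular one_regular total_quotient_ring_zero
        l_minus l_neg)
  then show ?thesis
    using assms by (intro T.minus_equality) (simp_all add: fraction_closed)
qed

text \<open>Every generator \<open>j x\<close> is a fraction whose numerator is a multiple of
  \<open>j\<close>, hence in \<open>J\<close>. This shape survives sums, because over the common
  denominator \<open>s t\<close> the new numerator \<open>i t + j s\<close> is again in
  \<open>J\<close>.\<close>

lemma (in cring) ideal_submodule_prod_fraction:
  assumes J: "ideal J R" and K: "submodule K R (total_quotient_ring R)"
    and X: "X \<in> ideal_submodule_prod R J K"
  shows "\<exists>j\<in>J. \<exists>s\<in>regular_elements R. X = fraction R j s"
proof -
  interpret J: ideal J R by (rule J)
  have Kc: "K \<subseteq> carrier (total_quotient_ring R)"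
    using K by (auto simp: submodule_def dest!: subgroup.subset)
  have gen: "\<exists>i\<in>J. \<exists>s\<in>regular_elements R. j \<odot>\<^bsub>total_quotient_ring R\<^esub> x = fraction R i s"
    if j: "j \<in> J" and "x \<in> K" for j x
  proof -
    obtain a s where "a \<in> carrier R" "s \<in> regular_elements R" "x = fraction R a s"
      using \<open>x \<in> K\<close> Kc by (blast elim: total_quotient_ring_cases)
    then show ?thesis
      using j J.Icarr[OF j] by (auto simp: fraction_smult J.I_r_closed intro!: bexI)
  qed
  show ?thesis
    using X unfolding ideal_submodule_prod_def
  proof (induction rule: generate.induct)
    case one
    then show ?case
      using total_quotient_ring_zero one_regular J.zero_closed by auto
  next
    case (incl X)
    then show ?case using gen by auto
  next
    case (inv X)
    then obtain j x where X: "X = j \<odot>\<^bsub>total_quotient_ring R\<^esub> x" and jx: "j \<in> J" "x \<in> K"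
      by blast
    then obtain i s where "i \<in> J" "s \<in> regular_elements R" "X = fraction R i s"
      using gen[OF jx] unfolding X by blast
    then show ?case
      using fraction_a_inv[of i s] J.Icarr J.a_inv_closed by (auto simp: a_inv_def)
  next
    case (eng X Y)
    then obtain i s j t where "i \<in> J" "s \<in> regular_elements R" "X = fraction R i s"
      "j \<in> J" "t \<in> regular_elements R" "Y = fraction R j t" by auto
    then show ?case
      using fraction_add[of i s j t] J.Icarr regular_closed mult_regular J.I_r_closed J.a_closed
      by (intro bexI[of _ "i \<otimes> t \<oplus> j \<otimes> s"] bexI[of _ "s \<otimes> t"]) auto
  qed
qed

text \<open>The fraction \<open>1/1\<close> lies in the product of \<open>J\<close> and its inverse,
  so it equals \<open>j/s\<close> with \<open>j\<close> in \<open>J\<close> and \<open>s\<close>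
  regular. Cross-multiplying gives \<open>j = s\<close>.\<close>

lemma (in cring) invertible_ideal_regular:
  assumes "invertible_ideal J R"
  obtains s where "s \<in> J" "s \<in> regular_elements R"
proof -
  obtain K where J: "ideal J R" and K: "submodule K R (total_quotient_ring R)"
    and eq: "ideal_submodule_prod R J K = (\<lambda>r. fraction R r \<one>) ` carrier R"
    using assms by (auto simp: invertible_ideal_def)
  have "fraction R \<one> \<one> \<in> ideal_submodule_prod R J K"
    unfolding eq by blast
  from ideal_submodule_prod_fraction[OF J K this] obtain j s
    where js: "j \<in> J" "s \<in> regular_elements R" "fraction R \<one> \<one> = fraction R j s" by blast
  then have "j = s"
    using ideal.Icarr[OF J js(1)] regular_closed[OF js(2)] one_regular
    by (simp add: fraction_eq_iff)
  then show ?thesis using js that by blast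
qed

text \<open>The image of the ring in its total quotient ring serves as the inverse. It is a
  submodule, and scaling by all of \<open>R\<close>, including \<open>\<one>\<close>, reproduces
  it.\<close>

lemma (in cring) invertible_ideal_carrier: "invertible_ideal (carrier R) R"
proof -
  interpret TA: algebra R "total_quotient_ring R" by (rule algebra_total_quotient_ring)
  define K where "K = (\<lambda>r. fraction R r \<one>) ` carrier R"
  have K: "submodule K R (total_quotient_ring R)"
    by (rule TA.submoduleI)
       (auto simp: K_def fraction_closed one_regular fraction_a_inv fraction_add fraction_smult
         total_quotient_ring_zero)
  have gen: "{j \<odot>\<^bsub>total_quotient_ring R\<^esub> x | j x. j \<in> carrier R \<and> x \<in> K} = K"
  proof
    show "{j \<odot>\<^bsub>total_quotient_ring R\<^esub> x | j x. j \<in> carrier R \<and> x \<in> K} \<subseteq> K"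
      using submodule.smult_closed[OF K] by blast
    show "K \<subseteq> {j \<odot>\<^bsub>total_quotient_ring R\<^esub> x | j x. j \<in> carrier R \<and> x \<in> K}"
    proof
      fix x assume x: "x \<in> K"
      then have "x = \<one> \<odot>\<^bsub>total_quotient_ring R\<^esub> x"
        using TA.smult_one TA.submoduleE(1)[OF K] by auto
      then show "x \<in> {j \<odot>\<^bsub>total_quotient_ring R\<^esub> x | j x. j \<in> carrier R \<and> x \<in> K}"
        using x one_closed by blast
    qed
  qed
  have "ideal_submodule_prod R (carrier R) K = K"
    unfolding ideal_submodule_prod_def gen
    using group.generate_subgroup_incl[OF TA.M.a_group subset_refl submodule.axioms(1)[OF K]]
    by (auto intro: generate.incl)
  then show ?thesis
    using K oneideal by (auto simp: invertible_ideal_def K_def)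
qed

section \<open>Products of radical ideals alone, and nilpotent elements\<close>

lemma (in cring) ideal_prod_carrier_left:
  assumes "ideal I R"
  shows "ideal_prod R (carrier R) I = I"
  using ideal_prod_inter[OF oneideal assms] ideal_prod.prod[of \<one> "carrier R" _ I R]
    ideal.Icarr[OF assms] by fastforce

text \<open>The whole ring is an invertible ideal and can fill the invertible slot, so a product of
  radical ideals alone is already a factorization of the required kind.\<close>

lemma (in cring) ISP_factorization_foldl_carrier:
  assumes "Hs \<noteq> []" "\<And>H. H \<in> set Hs \<Longrightarrow> radical_ideal H R"
  shows "ISP_factorization R (foldl (ideal_prod R) (carrier R) Hs)"
  using assms invertible_ideal_carrier by (auto simp: ISP_factorization_def)

lemma (in cring) radical_ideal_nilpotent:
  assumes "radical_ideal H R" "x \<in> carrier R" "x [^] (n::nat) = \<zero>"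
  shows "x \<in> H"
proof -
  have "ideal H R" and rad: "ideal_radical R H = H"
    using assms(1) by (auto simp: radical_ideal_def proper_ideal_def)
  then interpret H: ideal H R by simp
  \<comment> \<open>The given exponent may be 0, while \<open>ideal_radical\<close> asks for a
    positive one; raising it by one repairs this.\<close>
  have "x [^] Suc n = \<zero>" using assms by simp
  then have "x \<in> ideal_radical R H"
    using assms(2) by (auto simp: ideal_radical_def intro!: exI[of _ "Suc n"])
  then show ?thesis by (simp add: rad)
qed

section \<open>Invariance under isomorphism\<close>

text \<open>Isomorphism is stated as a bijective homomorphism, so every transport lemma below can be
  reused for the inverse map.\<close>

locale cring_iso = ring_hom_cring R S h for R (structure) and S (structure) and h +
  assumes bij: "bij_betw h (carrier R) (carrier S)"
begin

lemma h_eq_iff: "\<lbrakk>x \<in> carrier R; y \<in> carrier R\<rbrakk> \<Longrightarrow> h x = h y \<longleftrightarrow> x = y"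
  using bij by (auto simp: bij_betw_def inj_on_def)

lemma h_onto: "h ` carrier R = carrier S"
  using bij by (simp add: bij_betw_def)

lemma image_mem_iff: "\<lbrakk>x \<in> carrier R; I \<subseteq> carrier R\<rbrakk> \<Longrightarrow> h x \<in> h ` I \<longleftrightarrow> x \<in> I"
  using inj_on_image_mem_iff[of h "carrier R" x I] bij by (simp add: bij_betw_def)

lemma h_eq_zero_iff: "x \<in> carrier R \<Longrightarrow> h x = \<zero>\<^bsub>S\<^esub> \<longleftrightarrow> x = \<zero>"
  using h_eq_iff[of x \<zero>] by simp

lemma regular_iff: "x \<in> carrier R \<Longrightarrow> h x \<in> regular_elements S \<longleftrightarrow> x \<in> regular_elements R"
  by (simp add: regular_elements_def h_onto[symmetric] h_eq_zero_iff flip: hom_mult)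

lemma ideal_image:
  assumes "ideal I R"
  shows "ideal (h ` I) S"
proof -
  interpret I: ideal I R by (rule assms)
  show ?thesis
  proof (rule idealI[OF S.ring_axioms])
    show "subgroup (h ` I) (add_monoid S)"
      using group_hom.subgroup_img_is_subgroup[OF ring.a_group_hom I.a_subgroup] .
  qed (auto simp: h_onto[symmetric] I.Icarr I.I_l_closed I.I_r_closed simp flip: hom_mult)
qed

lemma proper_ideal_image:
  assumes "proper_ideal I R"
  shows "proper_ideal (h ` I) S"
proof -
  have I: "ideal I R" "I \<noteq> carrier R" using assms by (auto simp: proper_ideal_def)
  then have "I \<subseteq> carrier R" by (auto dest: ideal.Icarr)
  then have "h ` I \<noteq> carrier S"
    using I(2) bij by (metis bij_betw_def h_onto inj_on_image_eq_iff subset_refl)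
  then show ?thesis
    using ideal_image I by (simp add: proper_ideal_def)
qed

text \<open>Powers commute with \<open>h\<close>, and by injectivity \<open>h x\<close> lies in the
  image of \<open>H\<close> only if \<open>x\<close> lies in \<open>H\<close>. So forming the
  radical commutes with taking images.\<close>

lemma radical_ideal_image:
  assumes "radical_ideal H R"
  shows "radical_ideal (h ` H) S"
proof -
  have H: "proper_ideal H R" and rad: "ideal_radical R H = H"
    using assms by (auto simp: radical_ideal_def)
  then have Hc: "H \<subseteq> carrier R" by (auto simp: proper_ideal_def dest: ideal.Icarr)
  have iff: "h x \<in> ideal_radical S (h ` H) \<longleftrightarrow> x \<in> ideal_radical R H" if "x \<in> carrier R" for x
    using that Hc by (simp add: ideal_radical_def image_mem_iff flip: ring.hom_nat_pow)
  have "ideal_radical S (h ` H) = h ` ideal_radical R H"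
  proof
    show "h ` ideal_radical R H \<subseteq> ideal_radical S (h ` H)"
      using iff by (auto simp: ideal_radical_def)
    show "ideal_radical S (h ` H) \<subseteq> h ` ideal_radical R H"
    proof
      fix y assume y: "y \<in> ideal_radical S (h ` H)"
      then have "y \<in> h ` carrier R" unfolding h_onto by (simp add: ideal_radical_def)
      then show "y \<in> h ` ideal_radical R H" using iff y by blast
    qed
  qed
  then show ?thesis
    using proper_ideal_image[OF H] by (simp add: radical_ideal_def rad)
qed

lemma ideal_prod_image:
  assumes "I \<subseteq> carrier R" "J \<subseteq> carrier R"
  shows "h ` ideal_prod R I J = ideal_prod S (h ` I) (h ` J)"
proof
  \<comment> \<open>Membership in the carrier is carried through the induction because additivity of
    \<open>h\<close> is available only there. The converse inclusion uses the same
    strengthening.\<close>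
  have "x \<in> carrier R \<and> h x \<in> ideal_prod S (h ` I) (h ` J)" if "x \<in> ideal_prod R I J" for x
    using that
  proof (induction rule: ideal_prod.induct)
    case (prod i j)
    then have "i \<in> carrier R" "j \<in> carrier R" using assms by blast+
    then show ?case using prod by (auto intro!: ideal_prod.prod)
  next
    case (sum x y)
    then show ?case by (auto intro!: ideal_prod.sum)
  qed
  then show "h ` ideal_prod R I J \<subseteq> ideal_prod S (h ` I) (h ` J)" by blast
  have "\<exists>x\<in>ideal_prod R I J \<inter> carrier R. y = h x" if "y \<in> ideal_prod S (h ` I) (h ` J)" for y
    using that
  proof (induction rule: ideal_prod.induct)
    case (prod i j)
    then obtain a b where "a \<in> I" "b \<in> J" "i = h a" "j = h b" by blast
    moreover from this have "a \<in> carrier R" "b \<in> carrier R" using assms by blast+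
    ultimately show ?case
      by (intro bexI[of _ "a \<otimes> b"]) (auto intro!: ideal_prod.prod)
  next
    case (sum x y)
    then obtain a b where "a \<in> ideal_prod R I J \<inter> carrier R" "b \<in> ideal_prod R I J \<inter> carrier R"
      "x = h a" "y = h b" by blast
    then show ?case
      by (intro bexI[of _ "a \<oplus> b"]) (auto intro!: ideal_prod.sum)
  qed
  then show "ideal_prod S (h ` I) (h ` J) \<subseteq> h ` ideal_prod R I J" by blast
qed

lemma foldl_ideal_prod_image:
  assumes "ideal J R" "\<And>H. H \<in> set Hs \<Longrightarrow> ideal H R"
  shows "h ` foldl (ideal_prod R) J Hs = foldl (ideal_prod S) (h ` J) (map ((`) h) Hs)"
  using assms
proof (induction Hs arbitrary: J)
  case (Cons H Hs)
  then have "ideal H R" by simp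
  with Cons.prems(1) have "J \<subseteq> carrier R" "H \<subseteq> carrier R"
    by (auto dest: ideal.Icarr)
  then show ?case
    using Cons R.ideal_prod_is_ideal[OF Cons.prems(1) \<open>ideal H R\<close>] by (simp add: ideal_prod_image)
qed simp

section \<open>Invertible ideals and factorizations under an isomorphism\<close>

text \<open>Fractions are sets of pairs, so the induced isomorphism of total quotient rings is an image map.\<close>

lemma fraction_image:
  assumes "a \<in> carrier R" "s \<in> regular_elements R"
  shows "map_prod h h ` fraction R a s = fraction S (h a) (h s)"
proof
  have s: "s \<in> carrier R" by (rule R.regular_closed[OF assms(2)])
  show "map_prod h h ` fraction R a s \<subseteq> fraction S (h a) (h s)"
    using assms s R.regular_closed
    by (auto simp: fraction_def fraction_rel_def regular_iff simp flip: hom_mult)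
  show "fraction S (h a) (h s) \<subseteq> map_prod h h ` fraction R a s"
  proof clarify
    fix x y assume xy: "(x, y) \<in> fraction S (h a) (h s)"
    then have "x \<in> h ` carrier R" "y \<in> h ` carrier R"
      unfolding h_onto using S.fraction_memD S.regular_closed by blast+
    then obtain b t where bt: "b \<in> carrier R" "t \<in> carrier R" "x = h b" "y = h t" by blast
    then have "(b, t) \<in> fraction R a s"
      using assms s xy
      by (auto simp: fraction_def fraction_rel_def regular_iff h_eq_iff simp flip: hom_mult)
    then show "(x, y) \<in> map_prod h h ` fraction R a s"
      using bt by force
  qed
qed

text \<open>The map \<open>\<phi>\<close> induced on total quotient rings is additive and semilinear
  along \<open>h\<close>. It therefore sends the inverse \<open>K\<close> to a submodule, generators
  of the product to generators, and the copy of \<open>R\<close> onto the copy of \<open>S\<close>;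
  so \<open>\<phi>\<close> applied to \<open>K\<close> inverts the image of
  \<open>J\<close>.\<close>

lemma invertible_ideal_image:
  assumes "invertible_ideal J R"
  shows "invertible_ideal (h ` J) S"
proof -
  let ?T = "total_quotient_ring R" and ?U = "total_quotient_ring S"
  interpret T: cring ?T by (rule R.cring_total_quotient_ring)
  interpret U: cring ?U by (rule S.cring_total_quotient_ring)
  obtain K where J: "ideal J R" and K: "submodule K R ?T"
    and eq: "ideal_submodule_prod R J K = (\<lambda>r. fraction R r \<one>) ` carrier R"
    using assms by (auto simp: invertible_ideal_def)
  have Jc: "J \<subseteq> carrier R" by (auto dest: ideal.Icarr[OF J])
  have Kg: "subgroup K (add_monoid ?T)" by (rule submodule.axioms(1)[OF K])
  then have Kc: "K \<subseteq> carrier ?T" by (auto dest!: subgroup.subset)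
  define \<phi> where "\<phi> = (\<lambda>X. map_prod h h ` X)"
  have \<phi>: "\<phi> (fraction R a s) = fraction S (h a) (h s)"
    if "a \<in> carrier R" "s \<in> regular_elements R" for a s
    using that by (simp add: \<phi>_def fraction_image)
  have smult: "\<phi> (r \<odot>\<^bsub>?T\<^esub> X) = h r \<odot>\<^bsub>?U\<^esub> \<phi> X" if "r \<in> carrier R" "X \<in> carrier ?T" for r X
    using that(2,1) by (elim R.total_quotient_ring_cases)
      (simp add: \<phi> R.fraction_smult S.fraction_smult R.regular_closed regular_iff)
  have "group_hom (add_monoid ?T) (add_monoid ?U) \<phi>"
  proof (intro group_hom.intro group_hom_axioms.intro homI T.a_group U.a_group)
    fix X assume "X \<in> carrier (add_monoid ?T)"
    then have "X \<in> carrier ?T" by simp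
    then show "\<phi> X \<in> carrier (add_monoid ?U)"
      by (elim R.total_quotient_ring_cases)
        (simp add: \<phi> S.fraction_closed R.regular_closed regular_iff)
  next
    fix X Y assume "X \<in> carrier (add_monoid ?T)" "Y \<in> carrier (add_monoid ?T)"
    then have "X \<in> carrier ?T" "Y \<in> carrier ?T" by simp_all
    then show "\<phi> (X \<otimes>\<^bsub>add_monoid ?T\<^esub> Y) = \<phi> X \<otimes>\<^bsub>add_monoid ?U\<^esub> \<phi> Y"
      by (elim R.total_quotient_ring_cases)
        (simp add: \<phi> R.fraction_add S.fraction_add R.regular_closed regular_iff R.mult_regular)
  qed
  then interpret \<phi>: group_hom "add_monoid ?T" "add_monoid ?U" \<phi> .
  have sub: "submodule (\<phi> ` K) S ?U"
  proof (rule submodule.intro[OF \<phi>.subgroup_img_is_subgroup[OF Kg]], unfold_locales)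
    fix r X assume "r \<in> carrier S" "X \<in> \<phi> ` K"
    then obtain b Y where "b \<in> carrier R" "Y \<in> K" "r = h b" "X = \<phi> Y"
      by (auto simp: h_onto[symmetric])
    then show "r \<odot>\<^bsub>?U\<^esub> X \<in> \<phi> ` K"
      using smult[of b Y, symmetric] Kc submodule.smult_closed[OF K] by auto
  qed
  have gen: "{j \<odot>\<^bsub>?U\<^esub> x | j x. j \<in> h ` J \<and> x \<in> \<phi> ` K} = \<phi> ` {j \<odot>\<^bsub>?T\<^esub> x | j x. j \<in> J \<and> x \<in> K}"
    (is "?A = ?B")
  proof (rule Set.set_eqI)
    fix y
    have "y \<in> ?A \<longleftrightarrow> (\<exists>j\<in>J. \<exists>x\<in>K. y = h j \<odot>\<^bsub>?U\<^esub> \<phi> x)" by blast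
    also have "\<dots> \<longleftrightarrow> (\<exists>j\<in>J. \<exists>x\<in>K. y = \<phi> (j \<odot>\<^bsub>?T\<^esub> x))"
      by (intro bex_cong refl) (simp add: smult subsetD[OF Jc] subsetD[OF Kc])
    also have "\<dots> \<longleftrightarrow> y \<in> ?B" by blast
    finally show "y \<in> ?A \<longleftrightarrow> y \<in> ?B" .
  qed
  have "ideal_submodule_prod S (h ` J) (\<phi> ` K) = \<phi> ` ideal_submodule_prod R J K"
    unfolding ideal_submodule_prod_def gen
  proof (rule \<phi>.generate_img)
    show "{j \<odot>\<^bsub>?T\<^esub> x |j x. j \<in> J \<and> x \<in> K} \<subseteq> carrier (add_monoid ?T)"
      using submodule.smult_closed[OF K] Jc Kc by auto
  qed
  also have "\<dots> = (\<lambda>r. fraction S r \<one>\<^bsub>S\<^esub>) ` carrier S"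
    unfolding eq h_onto[symmetric] image_image
    by (rule image_cong) (simp_all add: \<phi> R.one_regular)
  finally show ?thesis
    using sub ideal_image[OF J] by (auto simp: invertible_ideal_def)
qed

lemma ISP_factorization_image:
  assumes "ISP_factorization R I"
  shows "ISP_factorization S (h ` I)"
proof -
  obtain J Hs where J: "invertible_ideal J R" and Hs: "Hs \<noteq> []" "\<forall>H\<in>set Hs. radical_ideal H R"
    and I: "I = foldl (ideal_prod R) J Hs"
    using assms by (auto simp: ISP_factorization_def)
  have "h ` I = foldl (ideal_prod S) (h ` J) (map ((`) h) Hs)"
    unfolding I using J Hs
    by (intro foldl_ideal_prod_image)
       (auto simp: invertible_ideal_def radical_ideal_def proper_ideal_def)
  then show ?thesis
    unfolding ISP_factorization_def using J Hs invertible_ideal_image radical_ideal_image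
    by (intro exI[of _ "h ` J"] exI[of _ "map ((`) h) Hs"]) auto
qed

lemma cring_iso_inv: "cring_iso S R (inv_into (carrier R) h)"
proof -
  have "inv_into (carrier R) h \<in> ring_iso S R"
    by (rule ring_iso_set_sym) (simp_all add: ring_iso_def bij R.ring_axioms)
  then show ?thesis
    by (auto simp: cring_iso_def cring_iso_axioms_def ring_hom_cring_def ring_hom_cring_axioms_def
      ring_iso_def R.is_cring S.is_cring)
qed

text \<open>An ideal of \<open>S\<close> is pulled back along the inverse isomorphism, factored in
  \<open>R\<close>, and the factorization is pushed forward again.\<close>

lemma all_ISP_factorization_image:
  assumes "\<And>I. proper_ideal I R \<Longrightarrow> ISP_factorization R I" and I: "proper_ideal I S"
  shows "ISP_factorization S I"
proof -
  have "h ` inv_into (carrier R) h ` I = I"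
    using I by (intro image_inv_into_cancel[OF h_onto]) (auto simp: proper_ideal_def dest: ideal.Icarr)
  then show ?thesis
    using ISP_factorization_image[OF assms(1)[OF cring_iso.proper_ideal_image[OF cring_iso_inv I]]]
    by simp
qed

end

section \<open>Trivial extensions by divisible modules\<close>

lemma trivial_extension_simps [simp]:
  "carrier (trivial_extension A E) = carrier A \<times> carrier E"
  "(a, e) \<otimes>\<^bsub>trivial_extension A E\<^esub> (b, f) = (a \<otimes>\<^bsub>A\<^esub> b, a \<odot>\<^bsub>E\<^esub> f \<oplus>\<^bsub>E\<^esub> b \<odot>\<^bsub>E\<^esub> e)"
  "\<one>\<^bsub>trivial_extension A E\<^esub> = (\<one>\<^bsub>A\<^esub>, \<zero>\<^bsub>E\<^esub>)"
  "\<zero>\<^bsub>trivial_extension A E\<^esub> = (\<zero>\<^bsub>A\<^esub>, \<zero>\<^bsub>E\<^esub>)"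
  "(a, e) \<oplus>\<^bsub>trivial_extension A E\<^esub> (b, f) = (a \<oplus>\<^bsub>A\<^esub> b, e \<oplus>\<^bsub>E\<^esub> f)"
  by (simp_all add: trivial_extension_def)

locale divisible_over_domain = module R M + domain R
  for R (structure) and M (structure) +
  assumes divisible: "divisible_module R M"
begin

abbreviation T where "T \<equiv> trivial_extension R M"

abbreviation Z where "Z \<equiv> {\<zero>} \<times> carrier M"

sublocale T: cring T
  by (rule cring_trivial_extension)

lemma T_a_inv:
  assumes "a \<in> carrier R" "e \<in> carrier M"
  shows "\<ominus>\<^bsub>T\<^esub> (a, e) = (\<ominus> a, \<ominus>\<^bsub>M\<^esub> e)"
  using assms by (intro T.minus_equality) (simp_all add: R.l_neg M.l_neg)

text \<open>In a domain every non-zero element is regular, so divisibility of the module applies to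
  it.\<close>

lemma divide:
  assumes "a \<in> carrier R" "a \<noteq> \<zero>" "e \<in> carrier M"
  obtains f where "f \<in> carrier M" "e = a \<odot>\<^bsub>M\<^esub> f"
proof -
  have "a \<in> regular_elements R"
    using assms integral by (auto simp: regular_elements_def)
  then have "carrier M = (\<lambda>e. a \<odot>\<^bsub>M\<^esub> e) ` carrier M"
    using divisible by (simp add: divisible_module_def)
  then show ?thesis using assms(3) that by blast
qed

section \<open>Ideals of the extension and submodules\<close>

lemma ideal_zero_times:
  assumes "submodule N R M"
  shows "ideal ({\<zero>} \<times> N) T"
proof (rule idealI[OF T.ring_axioms])
  note N = submoduleE[OF assms]
  have "\<zero>\<^bsub>M\<^esub> \<in> N"
    using submodule.axioms(1)[OF assms] subgroup.one_closed by fastforce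
  then show "subgroup ({\<zero>} \<times> N) (add_monoid T)"
    by (intro T.add.subgroupI) (use N in \<open>auto simp: T_a_inv simp flip: a_inv_def\<close>)
  fix x y assume "x \<in> {\<zero>} \<times> N" "y \<in> carrier T"
  then show "y \<otimes>\<^bsub>T\<^esub> x \<in> {\<zero>} \<times> N" "x \<otimes>\<^bsub>T\<^esub> y \<in> {\<zero>} \<times> N"
    using N by auto
qed

lemma ideal_Z: "ideal Z T"
  by (rule ideal_zero_times[OF carrier_is_submodule])

lemma proper_ideal_zero_times:
  assumes "submodule N R M"
  shows "proper_ideal ({\<zero>} \<times> N) T"
proof -
  have "{\<zero>} \<times> N \<noteq> carrier T"
  proof
    assume eq: "{\<zero>} \<times> N = carrier T"
    have "\<one>\<^bsub>T\<^esub> \<in> {\<zero>} \<times> N" unfolding eq by (rule T.one_closed)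
    then show False by simp
  qed
  then show ?thesis
    using ideal_zero_times[OF assms] by (simp add: proper_ideal_def)
qed

text \<open>The scalar action of \<open>a\<close> on the second component is multiplication by
  \<open>(a, 0)\<close> in the extension, so absorption by the ideal gives closure under
  scalars.\<close>

lemma submodule_of_ideal:
  assumes "ideal I T"
  shows "submodule {e. (\<zero>, e) \<in> I} R M"
proof (rule submoduleI)
  interpret I: ideal I T by (rule assms)
  show sub: "{e. (\<zero>, e) \<in> I} \<subseteq> carrier M"
    using I.Icarr by auto
  show "\<zero>\<^bsub>M\<^esub> \<in> {e. (\<zero>, e) \<in> I}"
    using I.zero_closed by simp
  show "\<ominus>\<^bsub>M\<^esub> e \<in> {e. (\<zero>, e) \<in> I}" if "e \<in> {e. (\<zero>, e) \<in> I}" for e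
  proof -
    have "\<ominus>\<^bsub>T\<^esub> (\<zero>, e) = (\<zero>, \<ominus>\<^bsub>M\<^esub> e)"
      using T_a_inv[of \<zero> e] that sub by auto
    moreover have "\<ominus>\<^bsub>T\<^esub> (\<zero>, e) \<in> I"
      using that by (intro I.a_inv_closed) simp
    ultimately show ?thesis by simp
  qed
  show "e \<oplus>\<^bsub>M\<^esub> f \<in> {e. (\<zero>, e) \<in> I}" if "e \<in> {e. (\<zero>, e) \<in> I}" "f \<in> {e. (\<zero>, e) \<in> I}" for e f
    using I.a_closed[of "(\<zero>, e)" "(\<zero>, f)"] that by auto
  show "a \<odot>\<^bsub>M\<^esub> e \<in> {e. (\<zero>, e) \<in> I}" if "a \<in> carrier R" "e \<in> {e. (\<zero>, e) \<in> I}" for a e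
    using I.I_l_closed[of "(\<zero>, e)" "(a, \<zero>\<^bsub>M\<^esub>)"] that sub by auto
qed

section \<open>Products of radical ideals in the extension\<close>

lemma Z_mult_Z: "ideal_prod T Z Z = {(\<zero>, \<zero>\<^bsub>M\<^esub>)}"
proof
  have "x = (\<zero>, \<zero>\<^bsub>M\<^esub>)" if "x \<in> ideal_prod T Z Z" for x
    using that by (induction rule: ideal_prod.induct) auto
  then show "ideal_prod T Z Z \<subseteq> {(\<zero>, \<zero>\<^bsub>M\<^esub>)}" by blast
  show "{(\<zero>, \<zero>\<^bsub>M\<^esub>)} \<subseteq> ideal_prod T Z Z"
    using ideal.axioms(1)[OF T.ideal_prod_is_ideal[OF ideal_Z ideal_Z]]
      additive_subgroup.zero_closed by fastforce
qed

text \<open>Elements of \<open>Z\<close> square to zero, and a radical ideal contains all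
  nilpotents.\<close>

lemma Z_subset_radical:
  assumes "radical_ideal H T"
  shows "Z \<subseteq> H"
proof
  fix x assume x: "x \<in> Z"
  then have "x [^]\<^bsub>T\<^esub> (2::nat) = \<zero>\<^bsub>T\<^esub>"
    by (auto simp: numeral_2_eq_2)
  then show "x \<in> H"
    using T.radical_ideal_nilpotent[OF assms] x by auto
qed

text \<open>Division by the non-zero first component of an element of I shows Z \<open>\<subseteq>\<close> I Z.\<close>

lemma mult_Z:
  assumes I: "ideal I T" and "(a, e) \<in> I" "a \<noteq> \<zero>"
  shows "ideal_prod T I Z = Z"
proof
  show "ideal_prod T I Z \<subseteq> Z"
    using T.ideal_prod_inter[OF I ideal_Z] by blast
  show "Z \<subseteq> ideal_prod T I Z"
  proof
    fix x assume "x \<in> Z"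
    then obtain f where f: "f \<in> carrier M" "x = (\<zero>, f)" by auto
    have c: "a \<in> carrier R" "e \<in> carrier M" using ideal.Icarr[OF I assms(2)] by auto
    obtain g where g: "g \<in> carrier M" "f = a \<odot>\<^bsub>M\<^esub> g"
      using divide[OF c(1) assms(3) f(1)] .
    have "(a, e) \<otimes>\<^bsub>T\<^esub> (\<zero>, g) \<in> ideal_prod T I Z"
      using assms(2) g by (intro ideal_prod.prod) auto
    then show "x \<in> ideal_prod T I Z"
      using c f g by simp
  qed
qed

text \<open>The three-way alternative is an invariant of multiplying by a radical ideal. Such an
  ideal has an element with non-zero first component or equals \<open>Z\<close>. Two ideals of the
  first kind give one of the first kind since \<open>R\<close> is a domain, the first kind times
  \<open>Z\<close> is \<open>Z\<close> by divisibility, and \<open>Z\<close> times \<open>Z\<close>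
  is zero.\<close>

lemma foldl_radical_cases:
  assumes "ideal J T" "\<And>H. H \<in> set Hs \<Longrightarrow> radical_ideal H T"
    and "(\<exists>a e. (a, e) \<in> J \<and> a \<noteq> \<zero>) \<or> J = Z \<or> J = {(\<zero>, \<zero>\<^bsub>M\<^esub>)}"
  shows "(\<exists>a e. (a, e) \<in> foldl (ideal_prod T) J Hs \<and> a \<noteq> \<zero>) \<or>
    foldl (ideal_prod T) J Hs = Z \<or> foldl (ideal_prod T) J Hs = {(\<zero>, \<zero>\<^bsub>M\<^esub>)}"
  using assms
proof (induction Hs arbitrary: J)
  case (Cons H Hs)
  have rad: "radical_ideal H T" using Cons.prems(2) by simp
  then have H: "ideal H T" by (simp add: radical_ideal_def proper_ideal_def)
  have HZ: "(\<exists>a e. (a, e) \<in> H \<and> a \<noteq> \<zero>) \<or> H = Z"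
    using Z_subset_radical[OF rad] ideal.Icarr[OF H] by auto
  have JH: "ideal (ideal_prod T J H) T"
    by (rule T.ideal_prod_is_ideal[OF Cons.prems(1) H])
  \<comment> \<open>\<open>mult_Z\<close> has \<open>Z\<close> as the right factor; commutativity
    serves the case where the accumulated product is \<open>Z\<close>.\<close>
  have comm: "ideal_prod T Z H = ideal_prod T H Z"
    by (rule T.ideal_prod_commute[OF ideal_Z H])
  consider a e b f where "(a, e) \<in> J" "a \<noteq> \<zero>" "(b, f) \<in> H" "b \<noteq> \<zero>"
    | a e where "(a, e) \<in> J" "a \<noteq> \<zero>" "H = Z"
    | b f where "(b, f) \<in> H" "b \<noteq> \<zero>" "J = Z"
    | "J = Z" "H = Z" | "J = {(\<zero>, \<zero>\<^bsub>M\<^esub>)}"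
    using HZ Cons.prems(3) by blast
  then have "(\<exists>a e. (a, e) \<in> ideal_prod T J H \<and> a \<noteq> \<zero>) \<or> ideal_prod T J H = Z \<or>
    ideal_prod T J H = {(\<zero>, \<zero>\<^bsub>M\<^esub>)}"
  proof cases
    case 1
    then have "(a, e) \<otimes>\<^bsub>T\<^esub> (b, f) \<in> ideal_prod T J H"
      by (intro ideal_prod.prod)
    moreover have "a \<otimes> b \<noteq> \<zero>"
      using integral 1 ideal.Icarr[OF Cons.prems(1)] ideal.Icarr[OF H] by fastforce
    ultimately show ?thesis by auto
  next
    case 2
    then show ?thesis using mult_Z Cons.prems(1) by blast
  next
    case 3
    then show ?thesis using mult_Z H comm by blast
  next
    case 4
    then show ?thesis using Z_mult_Z by blast
  next
    case 5
    then have "ideal_prod T J H \<subseteq> {(\<zero>, \<zero>\<^bsub>M\<^esub>)}"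
      using T.ideal_prod_inter[OF Cons.prems(1) H] by blast
    moreover have "(\<zero>, \<zero>\<^bsub>M\<^esub>) \<in> ideal_prod T J H"
      using additive_subgroup.zero_closed[OF ideal.axioms(1)[OF JH]] by simp
    ultimately show ?thesis by blast
  qed
  then show ?case
    using Cons.IH[OF JH] Cons.prems(2) by simp
qed simp

text \<open>The factorization of the ideal \<open>0 \<times> N\<close> is fed into
  \<open>foldl_radical_cases\<close>, which recovers \<open>N\<close> as zero or everything.\<close>

lemma simple_if_strongly_ISP_ring:
  assumes "strongly_ISP_ring T"
  shows "simple_module R M"
  unfolding simple_module_def
proof (intro conjI allI impI)
  show "module R M" by (rule module_axioms)
  fix N assume N: "submodule N R M"
  have N0: "\<zero>\<^bsub>M\<^esub> \<in> N"
    using submodule.axioms(1)[OF N] subgroup.one_closed by fastforce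
  show "N = {\<zero>\<^bsub>M\<^esub>} \<or> N = carrier M"
  proof (cases "carrier M = {\<zero>\<^bsub>M\<^esub>}")
    case True
    then show ?thesis using submoduleE(1)[OF N] N0 by auto
  next
    case False
    then obtain e where e: "e \<in> carrier M" "e \<noteq> \<zero>\<^bsub>M\<^esub>" by blast
    obtain J Hs where J: "invertible_ideal J T" and Hs: "\<forall>H\<in>set Hs. radical_ideal H T"
      and eq: "{\<zero>} \<times> N = foldl (ideal_prod T) J Hs"
      using assms proper_ideal_zero_times[OF N]
      by (auto simp: strongly_ISP_ring_def ISP_factorization_def)
    have Ji: "ideal J T" using J by (simp add: invertible_ideal_def)
    obtain s where s: "s \<in> J" "s \<in> regular_elements T"
      using T.invertible_ideal_regular[OF J] .
    obtain a f where sa: "s = (a, f)" by (cases s)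
    \<comment> \<open>A pair with first component zero annihilates \<open>(0, e)\<close>, which is
      non-zero, so it cannot be regular.\<close>
    have "a \<noteq> \<zero>"
    proof
      assume "a = \<zero>"
      then have "s \<otimes>\<^bsub>T\<^esub> (\<zero>, e) = \<zero>\<^bsub>T\<^esub>"
        using sa e ideal.Icarr[OF Ji s(1)] by simp
      moreover have "(\<zero>, e) \<in> carrier T" using e by simp
      ultimately have "(\<zero>, e) = \<zero>\<^bsub>T\<^esub>"
        using s(2) unfolding regular_elements_def by blast
      then show False using e by simp
    qed
    \<comment> \<open>All first components in \<open>0 \<times> N\<close> vanish, which excludes the
      first of the three alternatives.\<close>
    then have "{\<zero>} \<times> N = Z \<or> {\<zero>} \<times> N = {(\<zero>, \<zero>\<^bsub>M\<^esub>)}"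
      using foldl_radical_cases[OF Ji, of Hs] Hs s sa unfolding eq[symmetric] by blast
    then show ?thesis by auto
  qed
qed

text \<open>If \<open>e \<noteq> 0\<close> generates the simple module M, divisibility gives \<open>e = a b e\<close>. An element that kills
  \<open>e\<close> kills M, so by divisibility it is zero; hence \<open>a b = 1\<close>.\<close>

lemma field_if_simple:
  assumes simple: "simple_module R M" and e: "e \<in> carrier M" "e \<noteq> \<zero>\<^bsub>M\<^esub>"
  shows "field R"
proof -
  define N where "N = (\<lambda>a. a \<odot>\<^bsub>M\<^esub> e) ` carrier R"
  have "submodule N R M"
  proof (rule submoduleI)
    show "\<zero>\<^bsub>M\<^esub> \<in> N"
      using e by (auto simp: N_def intro!: image_eqI[of _ _ \<zero>])
    show "\<ominus>\<^bsub>M\<^esub> x \<in> N" if "x \<in> N" for x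
      using that e by (auto simp: N_def smult_l_minus[symmetric])
    show "x \<oplus>\<^bsub>M\<^esub> y \<in> N" if "x \<in> N" "y \<in> N" for x y
      using that e by (auto simp: N_def smult_l_distr[symmetric])
    show "a \<odot>\<^bsub>M\<^esub> x \<in> N" if "a \<in> carrier R" "x \<in> N" for a x
      using that e by (auto simp: N_def smult_assoc1[symmetric])
  qed (use e in \<open>auto simp: N_def\<close>)
  moreover have "e \<in> N"
    using e by (auto simp: N_def intro!: image_eqI[of _ _ \<one>])
  ultimately have N: "carrier M = (\<lambda>a. a \<odot>\<^bsub>M\<^esub> e) ` carrier R"
    using simple e by (auto simp: simple_module_def N_def)
  have faithful: "c = \<zero>" if c: "c \<in> carrier R" "c \<odot>\<^bsub>M\<^esub> e = \<zero>\<^bsub>M\<^esub>" for c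
  proof (rule ccontr)
    assume "c \<noteq> \<zero>"
    from divide[OF c(1) this e(1)] obtain f where f: "f \<in> carrier M" "e = c \<odot>\<^bsub>M\<^esub> f" .
    then obtain b where b: "b \<in> carrier R" "f = b \<odot>\<^bsub>M\<^esub> e" using N by auto
    have "e = c \<odot>\<^bsub>M\<^esub> (b \<odot>\<^bsub>M\<^esub> e)" by (rule f(2)[unfolded b(2)])
    also have "\<dots> = b \<odot>\<^bsub>M\<^esub> (c \<odot>\<^bsub>M\<^esub> e)"
      using b(1) c(1) e by (simp add: smult_assoc1[symmetric] R.m_comm)
    also have "\<dots> = \<zero>\<^bsub>M\<^esub>" using b(1) c by simp
    finally show False using e by simp
  qed
  show ?thesis
  proof (rule R.cring_fieldI2)
    show "\<zero> \<noteq> \<one>" by simp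
    fix a assume a: "a \<in> carrier R" "a \<noteq> \<zero>"
    from divide[OF this e(1)] obtain f where f: "f \<in> carrier M" "e = a \<odot>\<^bsub>M\<^esub> f" .
    then obtain b where b: "b \<in> carrier R" "f = b \<odot>\<^bsub>M\<^esub> e" using N by auto
    have "(a \<otimes> b) \<odot>\<^bsub>M\<^esub> e = a \<odot>\<^bsub>M\<^esub> (b \<odot>\<^bsub>M\<^esub> e)" using a b(1) e by (simp add: smult_assoc1)
    also have "\<dots> = e" by (rule f(2)[unfolded b(2), symmetric])
    finally have eab: "(a \<otimes> b) \<odot>\<^bsub>M\<^esub> e = e" .
    have "(a \<otimes> b \<ominus> \<one>) \<odot>\<^bsub>M\<^esub> e = \<zero>\<^bsub>M\<^esub>"
      using a b(1) e by (simp add: a_minus_def smult_l_distr smult_l_minus eab M.r_neg)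
    then have "a \<otimes> b \<ominus> \<one> = \<zero>" using faithful a b(1) by simp
    then have "a \<otimes> b = \<one>" using a b(1)
      by (metis R.add.inv_solve_right R.l_zero R.minus_eq R.zero_closed R.one_closed R.m_closed)
    then show "\<exists>b\<in>carrier R. a \<otimes> b = \<one>" using b(1) by blast
  qed
qed

lemma cring_iso_trivial:
  assumes "carrier M = {\<zero>\<^bsub>M\<^esub>}"
  shows "cring_iso R T (\<lambda>a. (a, \<zero>\<^bsub>M\<^esub>))"
proof
  show "(\<lambda>a. (a, \<zero>\<^bsub>M\<^esub>)) \<in> ring_hom R T"
    by (rule ring_hom_memI) auto
  show "bij_betw (\<lambda>a. (a, \<zero>\<^bsub>M\<^esub>)) (carrier R) (carrier T)"
    by (auto simp: bij_betw_def inj_on_def assms)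
qed

section \<open>Radical ideals, and factorizations over a field\<close>

lemma radical_ideal_zero: "radical_ideal {\<zero>} R"
proof -
  \<comment> \<open>For \<open>n = 0\<close> the premise says \<open>\<one> = \<zero>\<close>, which
    is impossible in a domain.\<close>
  have "x = \<zero>" if "x \<in> carrier R" "x [^] n = \<zero>" for x and n :: nat
    using that by (induction n) (auto simp: integral_iff)
  then have "ideal_radical R {\<zero>} \<subseteq> {\<zero>}"
    by (auto simp: ideal_radical_def)
  moreover have "\<zero> \<in> ideal_radical R {\<zero>}"
    unfolding ideal_radical_def by (intro CollectI conjI exI[of _ "1::nat"]) simp_all
  moreover have "{\<zero>} \<noteq> carrier R" using R.one_closed one_not_zero by blast
  ultimately show ?thesis
    using R.zeroideal by (simp add: radical_ideal_def proper_ideal_def subset_antisym)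
qed

text \<open>The first projection respects powers and \<open>Z\<close> is the preimage of the zero
  ideal, which is radical because \<open>R\<close> is a domain.\<close>

lemma radical_ideal_Z: "radical_ideal Z T"
proof -
  have pow: "fst (x [^]\<^bsub>T\<^esub> n) = fst x [^] n" if "x \<in> carrier T" for x and n :: nat
  proof (induction n)
    case (Suc n)
    then show ?case by (cases "x [^]\<^bsub>T\<^esub> n"; cases x) simp
  qed simp
  have "ideal_radical T Z = Z"
  proof
    show "Z \<subseteq> ideal_radical T Z"
    proof
      fix x assume x: "x \<in> Z"
      then have "x \<in> carrier T" by auto
      then show "x \<in> ideal_radical T Z"
        unfolding ideal_radical_def using x
        by (intro CollectI conjI exI[of _ "1::nat"]) (simp_all del: trivial_extension_simps)
    qed
    show "ideal_radical T Z \<subseteq> Z"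
    proof
      fix x assume "x \<in> ideal_radical T Z"
      then obtain n :: nat where x: "x \<in> carrier T" and n: "n > 0" "x [^]\<^bsub>T\<^esub> n \<in> Z"
        by (auto simp: ideal_radical_def)
      then have "fst x [^] n = \<zero>" using pow[OF x, of n] by auto
      then have "fst x \<in> ideal_radical R {\<zero>}"
        using x n by (auto simp: ideal_radical_def)
      moreover have "ideal_radical R {\<zero>} = {\<zero>}"
        using radical_ideal_zero unfolding radical_ideal_def by (rule conjunct2)
      ultimately have "fst x = \<zero>" by (simp only: singleton_iff)
      then show "x \<in> Z"
        using x by (cases x) simp
    qed
  qed
  then show ?thesis
    using proper_ideal_zero_times[OF carrier_is_submodule] by (simp add: radical_ideal_def)
qed

lemma ISP_factorization_field:
  assumes "field R" and I: "proper_ideal I R"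
  shows "ISP_factorization R I"
proof -
  have "I = {\<zero>}"
    using field.all_ideals[OF assms(1)] I by (auto simp: proper_ideal_def)
  then have "I = foldl (ideal_prod R) (carrier R) [{\<zero>}]"
    using R.ideal_prod_carrier_left[OF R.zeroideal] by simp
  then show ?thesis
    using R.ISP_factorization_foldl_carrier[of "[{\<zero>}]"] radical_ideal_zero by simp
qed

text \<open>Over a field an element of the extension with non-zero first component is a unit, so a
  proper ideal contains none.\<close>

lemma proper_ideal_subset_Z:
  assumes "field R" and I: "proper_ideal I T"
  shows "I \<subseteq> Z"
proof
  interpret field R by (rule assms(1))
  interpret I: ideal I T using I by (simp add: proper_ideal_def)
  fix x assume x: "x \<in> I"
  obtain a e where xa: "x = (a, e)" by (cases x)
  have c: "a \<in> carrier R" "e \<in> carrier M" using I.Icarr[OF x] xa by auto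
  have "a = \<zero>"
  proof (rule ccontr)
    assume nz: "a \<noteq> \<zero>"
    then have "a \<in> Units R" using c field_Units by simp
    then obtain b where b: "b \<in> carrier R" "a \<otimes> b = \<one>"
      using Units_r_inv_ex by blast
    \<comment> \<open>For \<open>b\<close> inverse to \<open>a\<close>, the product
      \<open>(a, e) (b, f)\<close> is \<open>(1, a f + b e)\<close>; this \<open>f\<close> makes the
      second component vanish.\<close>
    obtain f where f: "f \<in> carrier M" "\<ominus>\<^bsub>M\<^esub> (b \<odot>\<^bsub>M\<^esub> e) = a \<odot>\<^bsub>M\<^esub> f"
      using divide[OF c(1) nz] b c by (metis M.a_inv_closed smult_closed)
    have "x \<otimes>\<^bsub>T\<^esub> (b, f) = \<one>\<^bsub>T\<^esub>"
      using b c f(1) by (simp add: xa f(2)[symmetric] M.l_neg)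
    then have "\<one>\<^bsub>T\<^esub> \<in> I"
      using I.I_r_closed[OF x, of "(b, f)"] b f by simp
    then show False
      using I.one_imp_carrier I by (simp add: proper_ideal_def)
  qed
  then show "x \<in> Z" using xa c by simp
qed

text \<open>A proper ideal has the form \<open>0 \<times> N\<close> with \<open>N\<close> a
  submodule. By simplicity it is \<open>Z\<close> or zero, and zero is \<open>Z\<close> times
  \<open>Z\<close>.\<close>

lemma strongly_ISP_ring_if_field:
  assumes "field R" and simple: "simple_module R M"
  shows "strongly_ISP_ring T"
  unfolding strongly_ISP_ring_def
proof (intro conjI allI impI)
  show "cring T" by (rule T.is_cring)
  show "\<one>\<^bsub>T\<^esub> \<noteq> \<zero>\<^bsub>T\<^esub>" by simp
  fix I assume I: "proper_ideal I T"
  then have "submodule {e. (\<zero>, e) \<in> I} R M"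
    by (intro submodule_of_ideal) (simp add: proper_ideal_def)
  then have "{e. (\<zero>, e) \<in> I} = {\<zero>\<^bsub>M\<^esub>} \<or> {e. (\<zero>, e) \<in> I} = carrier M"
    using simple by (simp add: simple_module_def)
  moreover have "I = {\<zero>} \<times> {e. (\<zero>, e) \<in> I}"
    using proper_ideal_subset_Z[OF assms(1) I] by auto
  ultimately consider "I = {(\<zero>, \<zero>\<^bsub>M\<^esub>)}" | "I = Z" by fastforce
  then obtain Hs where "Hs \<noteq> []" "set Hs \<subseteq> {Z}" "I = foldl (ideal_prod T) (carrier T) Hs"
  proof cases
    case 1
    then show ?thesis
      using that[of "[Z, Z]"] Z_mult_Z T.ideal_prod_carrier_left[OF ideal_Z]
      by (simp del: trivial_extension_simps(1))
  next
    case 2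
    then show ?thesis
      using that[of "[Z]"] T.ideal_prod_carrier_left[OF ideal_Z]
      by (simp del: trivial_extension_simps(1))
  qed
  then show "ISP_factorization T I"
    using T.ISP_factorization_foldl_carrier[of Hs] radical_ideal_Z by auto
qed

theorem strongly_ISP_ring_trivial_extension_iff:
  "strongly_ISP_ring T \<longleftrightarrow> ISP_domain R \<and> simple_module R M"
proof (cases "carrier M = {\<zero>\<^bsub>M\<^esub>}")
  case True
  \<comment> \<open>For the zero module the extension is a copy of \<open>R\<close>, so
    factorizations transfer both ways, and the module is simple under the convention
    adopted.\<close>
  note h = cring_iso_trivial[OF this]
  have "(\<forall>I. proper_ideal I T \<longrightarrow> ISP_factorization T I) \<longleftrightarrow>
    (\<forall>I. proper_ideal I R \<longrightarrow> ISP_factorization R I)"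
    using cring_iso.all_ISP_factorization_image[OF h]
      cring_iso.all_ISP_factorization_image[OF cring_iso.cring_iso_inv[OF h]]
    by blast
  moreover have "simple_module R M"
    unfolding simple_module_def
  proof (intro conjI allI impI module_axioms)
    fix N assume "submodule N R M"
    from submoduleE(1,2)[OF this] show "N = {\<zero>\<^bsub>M\<^esub>} \<or> N = carrier M"
      unfolding True by blast
  qed
  ultimately show ?thesis
    by (simp add: strongly_ISP_ring_def ISP_domain_def domain_axioms T.is_cring)
next
  case False
  then obtain e where "e \<in> carrier M" "e \<noteq> \<zero>\<^bsub>M\<^esub>" by blast
  \<comment> \<open>Both directions pass through \<open>field R\<close>: a strongly ISP extension
    has a simple module, which makes \<open>R\<close> a field and hence an ISP-domain; conversely
    simplicity again gives a field, over which the ideals of the extension are explicit.\<close>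
  then show ?thesis
    using field_if_simple simple_if_strongly_ISP_ring ISP_factorization_field
      strongly_ISP_ring_if_field domain_axioms
    by (auto simp: ISP_domain_def)
qed

end

theorem proposition4p11:
  fixes A :: "('a, 'm) ring_scheme" and E :: "('a, 'e, 'n) module_scheme"
  assumes "domain A" and "module A E" and "divisible_module A E"
  shows "strongly_ISP_ring (trivial_extension A E) \<longleftrightarrow> ISP_domain A \<and> simple_module A E"
proof -
  interpret divisible_over_domain A E
    using assms by (simp add: divisible_over_domain_def divisible_over_domain_axioms_def)
  show ?thesis by (rule strongly_ISP_ring_trivial_extension_iff)
qed

end
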